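(* Let $\mathcal{H}$ and $\mathcal{K}$ be Hilbert spaces, let $B:\mathcal{H}\to\mathcal{K}$ be a bounded linear operator with closed range, and let $A_1\in L(\mathcal{H})^+$ and $A_2\in L(\mathcal{K})^+$ be positive semidefinite bounded operators. There exists $C\in L(\mathcal{K},\mathcal{H})$ such that $$BCB=B,\qquad CBC=C,\qquad A_1CB=B^*C^*A_1,\qquad A_2BC=C^*B^*A_2$$ if and only if $(A_1,N(B))$ and $(A_2,R(B))$ are compatible pairs.
   Context: Hilbert spaces are complex. $L(\mathcal{H},\mathcal{K})$ is the space of bounded linear operators from $\mathcal{H}$ to $\mathcal{K}$, $L(\mathcal{H})=L(\mathcal{H},\mathcal{H})$, and $L(\mathcal{H})^+$ is the cone of positive semidefinite operators in $L(\mathcal{H})$ (not assumed invertible or injective). $R(\cdot)$ and $N(\cdot)$ denote range and nullspace. For $A\in L(\mathcal{H})^+$ and a closed subspace $\mathcal{S}\subseteq\mathcal{H}$, the pair $(A,\mathcal{S})$ is called compatible if there exists $Q\in L(\mathcal{H})$ with $Q^2=Q$, $R(Q)=\mathcal{S}$ and $AQ=Q^*A$. *)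

theory Defs
  imports "HOL-Analysis.Analysis"
begin

text \<open>
  The library provides real, but not complex, inner product spaces. A complex vector space is
  taken as a real vector space whose real scalar multiplication is extended to \<open>complex\<close>; a
  complex inner product space is one whose underlying real inner product is the real part of
  a complex inner product. As \<open>cinner x x\<close> is real by conjugate symmetry, the norm of
  \<^class>\<open>real_inner\<close> is then the usual one, \<open>norm x = sqrt (cinner x x)\<close>, and positive
  definiteness is inherited. The inner product is linear in its first argument.
\<close>

class complex_vector = real_vector +
  fixes scaleC :: "complex \<Rightarrow> 'a \<Rightarrow> 'a"  (infixr \<open>*\<^sub>C\<close> 75)
  assumes scaleC_add_right: "c *\<^sub>C (x + y) = c *\<^sub>C x + c *\<^sub>C y"
    and scaleC_add_left: "(c + d) *\<^sub>C x = c *\<^sub>C x + d *\<^sub>C x"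
    and scaleC_scaleC: "c *\<^sub>C d *\<^sub>C x = (c * d) *\<^sub>C x"
    and scaleR_eq_scaleC: "r *\<^sub>R x = complex_of_real r *\<^sub>C x"

class complex_inner = complex_vector + real_inner +
  fixes cinner :: "'a \<Rightarrow> 'a \<Rightarrow> complex"
  assumes cinner_commute: "cinner x y = cnj (cinner y x)"
    and cinner_add_left: "cinner (x + y) z = cinner x z + cinner y z"
    and cinner_scaleC_left: "cinner (c *\<^sub>C x) y = c * cinner x y"
    and inner_eq_Re_cinner: "inner x y = Re (cinner x y)"

class chilbert_space = complex_inner + complete_space

definition bounded_clinear :: "('a::{complex_vector,real_normed_vector} \<Rightarrow>
    'b::{complex_vector,real_normed_vector}) \<Rightarrow> bool"
  where "bounded_clinear T \<longleftrightarrow>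
    bounded_linear T \<and> (\<forall>c x. T (c *\<^sub>C x) = c *\<^sub>C T x)"

text \<open>
  For a bounded operator between Hilbert spaces the function described here exists by the Riesz
  representation theorem, is unique, and is itself a bounded operator.
\<close>

definition cadjoint :: "('a::chilbert_space \<Rightarrow> 'b::chilbert_space) \<Rightarrow> 'b \<Rightarrow> 'a"
  where "cadjoint T = (THE T'. \<forall>x y. cinner (T x) y = cinner x (T' y))"

definition positive_operator :: "('a::chilbert_space \<Rightarrow> 'a) \<Rightarrow> bool"
  where "positive_operator A \<longleftrightarrow>
    bounded_clinear A \<and> (\<forall>x. cinner (A x) x \<in> \<real>\<^sub>\<ge>\<^sub>0)"

definition null_space :: "('a \<Rightarrow> 'b::zero) \<Rightarrow> 'a set"
  where "null_space T = {x. T x = 0}"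

definition compatible :: "('a::chilbert_space \<Rightarrow> 'a) \<Rightarrow> 'a set \<Rightarrow> bool"
  where "compatible A S \<longleftrightarrow>
    (\<exists>Q. bounded_clinear Q \<and> Q \<circ> Q = Q \<and> range Q = S \<and> A \<circ> Q = cadjoint Q \<circ> A)"

end

theory Submission
  imports Defs
begin

text \<open>
  Given \<open>C\<close>, the required projections are \<open>1 - CB\<close> onto \<open>N(B)\<close> and \<open>BC\<close> onto \<open>R(B)\<close>. Conversely,
  given projections \<open>Q\<^sub>1\<close> onto \<open>N(B)\<close> and \<open>Q\<^sub>2\<close> onto \<open>R(B)\<close>, let \<open>C\<close> be \<open>Q\<^sub>2\<close> followed by the
  inverse of the restriction of \<open>B\<close> to \<open>N(Q\<^sub>1)\<close>, so that \<open>CB = 1 - Q\<^sub>1\<close> and \<open>BC = Q\<^sub>2\<close>; since the range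
  of \<open>B\<close> is closed, \<open>C\<close> is bounded by the open mapping theorem.
\<close>

section \<open>Riesz representation by minimisation\<close>

text \<open>If \<open>z\<close> represents \<open>f\<close>, then \<open>inner x x - 2 * f x\<close>
  equals \<open>(norm (x - z))^2 - (norm z)^2\<close>, so \<open>z\<close> can only be the minimiser
  of this functional. Completeness supplies a minimiser, and a first-variation argument shows that
  it represents \<open>f\<close>.\<close>

lemma riesz_representation_real:
  fixes f :: "'a::{real_inner, complete_space} \<Rightarrow> real"
  assumes "bounded_linear f"
  obtains z where "\<And>h. f h = inner z h"
proof -
  interpret f: bounded_linear f by fact
  define \<phi> where "\<phi> x = inner x x - 2 * f x" for x
  obtain K where K: "\<And>x. norm (f x) \<le> norm x * K"
    using f.bounded by blast
  have lower: "- K\<^sup>2 \<le> \<phi> x" for x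
  proof -
    have "f x \<le> norm x * K" using K[of x] by simp
    moreover have "0 \<le> (norm x - K)\<^sup>2" by simp
    ultimately show ?thesis
      by (simp add: \<phi>_def power2_norm_eq_inner[symmetric] power2_diff)
  qed
  define m where "m = Inf (range \<phi>)"
  have bdd: "bdd_below (range \<phi>)" unfolding bdd_below_def using lower by blast
  have m_le: "m \<le> \<phi> x" for x
    unfolding m_def using bdd by (simp add: cInf_lower)
  have "\<exists>x. \<phi> x < m + inverse (real (Suc n))" for n
    using cInf_lessD[of "range \<phi>" "m + inverse (real (Suc n))"] by (auto simp: m_def)
  then obtain x where x: "\<And>n. \<phi> (x n) < m + inverse (real (Suc n))" by metis
  \<comment> \<open>The terms linear in \<open>f\<close> cancel, which leaves the parallelogram law.
    As the value at the midpoint is at least \<open>m\<close>, near-minimisers are close to each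
    other, so the minimising sequence is Cauchy.\<close>
  have parallelogram: "\<phi> u + \<phi> v - 2 * \<phi> ((1/2) *\<^sub>R (u + v)) = (norm (u - v))\<^sup>2 / 2" for u v
    by (simp add: \<phi>_def f.scaleR f.add power2_norm_eq_inner inner_add_left inner_add_right
        inner_diff_left inner_diff_right inner_commute field_simps)
  have dist: "(norm (u - v))\<^sup>2 \<le> 2 * ((\<phi> u - m) + (\<phi> v - m))" for u v
    using parallelogram[of u v] m_le[of "(1/2) *\<^sub>R (u + v)"] by simp
  have "Cauchy x"
  proof (rule metric_CauchyI)
    fix e :: real assume "0 < e"
    then obtain N where N: "inverse (real (Suc N)) < e\<^sup>2 / 4"
      using reals_Archimedean[of "e\<^sup>2 / 4"] by auto
    have small: "\<phi> (x n) - m < e\<^sup>2 / 4" if "n \<ge> N" for n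
    proof -
      have "inverse (real (Suc n)) \<le> inverse (real (Suc N))"
        using that by (simp add: field_simps)
      then show ?thesis using x[of n] N by linarith
    qed
    have "dist (x i) (x j) < e" if "i \<ge> N" "j \<ge> N" for i j
    proof -
      have "(norm (x i - x j))\<^sup>2 < e\<^sup>2"
        using dist[of "x i" "x j"] small[OF that(1)] small[OF that(2)] by argo
      then show ?thesis
        using \<open>0 < e\<close> by (simp add: dist_norm power_less_imp_less_base)
    qed
    then show "\<exists>M. \<forall>i\<ge>M. \<forall>j\<ge>M. dist (x i) (x j) < e" by blast
  qed
  then obtain z where z: "x \<longlonglongrightarrow> z"
    using Cauchy_convergent convergent_def by blast
  have "(\<lambda>n. \<phi> (x n)) \<longlonglongrightarrow> \<phi> z"
    unfolding \<phi>_def by (intro tendsto_intros f.tendsto z)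
  moreover have "(\<lambda>n. m + inverse (real (Suc n))) \<longlonglongrightarrow> m + 0"
    by (intro tendsto_intros LIMSEQ_inverse_real_of_nat)
  ultimately have "\<phi> z \<le> m + 0"
    by (rule LIMSEQ_le) (use x less_imp_le in blast)
  then have z_min: "\<phi> z \<le> \<phi> y" for y
    using m_le[of y] by simp
  have "f h = inner z h" for h
  proof (rule ccontr)
    define a where "a = inner z h - f h"
    define b where "b = inner h h"
    assume "f h \<noteq> inner z h"
    then have a: "a \<noteq> 0" by (simp add: a_def)
    have b: "b \<ge> 0" by (simp add: b_def)
    \<comment> \<open>The exact minimiser along the line through \<open>z\<close> in direction
      \<open>h\<close> would be \<open>- a / b\<close>; the denominator \<open>b + 1\<close> still
      gives a strict decrease and cannot vanish.\<close>
    define t where "t = - a / (b + 1)"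
    have "\<phi> (z + t *\<^sub>R h) - \<phi> z = t\<^sup>2 * b + 2 * t * a"
      by (simp add: \<phi>_def a_def b_def f.scaleR f.add inner_add_left inner_add_right
          inner_commute power2_eq_square algebra_simps)
    also have "\<dots> = - (a\<^sup>2 * (b + 2)) / (b + 1)\<^sup>2"
      using b unfolding t_def by (simp add: field_simps power2_eq_square add_nonneg_eq_0_iff)
    also have "\<dots> < 0"
      using a b by (simp add: divide_neg_pos)
    finally show False using z_min[of "z + t *\<^sub>R h"] by simp
  qed
  then show ?thesis using that by blast
qed

section \<open>Complex inner products and adjoints\<close>

lemma cinner_eqI:
  fixes u v :: "'a::complex_inner"
  assumes "\<And>x. cinner x u = cinner x v"
  shows "u = v"
proof -
  have "inner (u - v) (u - v) = 0"
    using assms[of "u - v"] by (simp add: inner_diff_right inner_eq_Re_cinner[of "u - v" u]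
        inner_eq_Re_cinner[of "u - v" v])
  then show ?thesis by simp
qed

lemma scaleC_diff_right: "c *\<^sub>C (x - y) = c *\<^sub>C x - c *\<^sub>C (y::'a::complex_vector)"
  using scaleC_add_right[of c "x - y" y] by simp

lemma cinner_diff_left: "cinner (x - y) z = cinner x z - cinner (y::'a::complex_inner) z"
  using cinner_add_left[of "x - y" y z] by simp

lemma cinner_add_right: "cinner z (x + y) = cinner z x + cinner z (y::'a::complex_inner)"
  by (metis cinner_add_left cinner_commute complex_cnj_add)

lemma cinner_diff_right: "cinner z (x - y) = cinner z x - cinner z (y::'a::complex_inner)"
  using cinner_add_right[of z "x - y" y] by simp

text \<open>Since Re (-i w) = Im w, the real inner product determines the complex one; this carries
  real identities over to \<open>cinner\<close>.\<close>

lemma cinner_eq_Complex_inner: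
  "cinner x y = Complex (inner x y) (inner ((- \<i>) *\<^sub>C x) (y::'a::complex_inner))"
  by (simp add: complex_eq_iff inner_eq_Re_cinner cinner_scaleC_left)

text \<open>Justifies the definite description in \<open>cadjoint\<close>: existence comes from real
  Riesz representation applied to \<open>inner (T h) y\<close> as a function of \<open>h\<close>,
  uniqueness from \<open>cinner_eqI\<close>.\<close>

lemma cinner_cadjoint:
  fixes T :: "'a::chilbert_space \<Rightarrow> 'b::chilbert_space"
  assumes "bounded_clinear T"
  shows "cinner (T x) y = cinner x (cadjoint T y)"
proof -
  have T: "bounded_linear T" and TC: "\<And>c x. T (c *\<^sub>C x) = c *\<^sub>C T x"
    using assms by (auto simp: bounded_clinear_def)
  have "\<exists>z. \<forall>h. inner (T h) y = inner h z" for y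
    using riesz_representation_real[OF bounded_linear_inner_left_comp[OF T, of y]]
    by (metis inner_commute)
  then obtain T' where "\<And>h y. inner (T h) y = inner h (T' y)" by metis
  \<comment> \<open>The real identity taken at -i x gives the imaginary parts, because
    \<open>T\<close> commutes with multiplication by -i.\<close>
  then have T': "\<forall>x y. cinner (T x) y = cinner x (T' y)"
    by (simp add: cinner_eq_Complex_inner TC[symmetric])
  have "cadjoint T = T'"
    unfolding cadjoint_def
  proof (rule the_equality)
    show "\<forall>x y. cinner (T x) y = cinner x (T' y)" by fact
    fix S assume "\<forall>x y. cinner (T x) y = cinner x (S y)"
    then show "S = T'" using T' by (intro ext cinner_eqI) metis
  qed
  then show ?thesis using T' by blast
qed

text \<open>Turns operator equations with an adjoint into sesquilinear identities, where sums and
  composites can be expanded directly.\<close>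

lemma eq_cadjoint_comp_iff:
  fixes Q :: "'a::chilbert_space \<Rightarrow> 'b::chilbert_space"
  assumes "bounded_clinear Q"
  shows "F = cadjoint Q \<circ> G \<longleftrightarrow> (\<forall>x y. cinner y (F x) = cinner (Q y) (G x))"
  by (auto simp: cinner_cadjoint[OF assms] fun_eq_iff intro: cinner_eqI)

lemma bounded_clinear_compose:
  assumes "bounded_clinear S" "bounded_clinear T"
  shows "bounded_clinear (S \<circ> T)"
  using assms bounded_linear_compose[of S T] by (simp add: bounded_clinear_def o_def)

lemma bounded_clinear_id_minus:
  assumes "bounded_clinear T"
  shows "bounded_clinear (\<lambda>x. x - T x)"
  using assms bounded_linear_sub[OF bounded_linear_ident, of T]
  by (simp add: bounded_clinear_def scaleC_diff_right)

section \<open>Operators with closed range\<close>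

text \<open>The open mapping theorem for operators with closed range, in the form of norm-controlled
  preimages.\<close>

lemma closed_range_bounded_preimage:
  fixes T :: "'a::{real_normed_vector, complete_space} \<Rightarrow> 'b::{real_normed_vector, complete_space}"
  assumes "bounded_linear T" and closed: "closed (range T)"
  obtains M where "M > 0" "\<And>y. y \<in> range T \<Longrightarrow> \<exists>x. T x = y \<and> norm x \<le> M * norm y"
proof -
  interpret T: bounded_linear T by fact
  define R where "R = range T"
  define F where "F n = closure (T ` cball 0 (real n))" for n
  have F_sub: "F n \<subseteq> R" for n
    unfolding F_def R_def using closed by (intro closure_minimal) auto
  have cover: "\<Union>(range F) = R"
  proof -
    have "T x \<in> \<Union>(range F)" for x
    proof -
      obtain n where "norm x \<le> real n" using real_arch_simple by blast
      then have "T x \<in> F n" unfolding F_def by (intro closure_subset[THEN subsetD]) simp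
      then show ?thesis by blast
    qed
    then show ?thesis using F_sub R_def by blast
  qed
  \<comment> \<open>Baire category inside \<open>R\<close>: as a closed subset of a complete space
    it is completely metrizable, and it is nonempty, so the closed sets \<open>F n\<close> covering
    it cannot all have empty relative interior.\<close>
  have "\<exists>n. top_of_set R interior_of F n \<noteq> {}"
  proof (rule ccontr)
    assume "\<not> ?thesis"
    moreover have "completely_metrizable_space (top_of_set R)"
      using completely_metrizable_space_closedin[OF completely_metrizable_space_euclidean] closed
      by (simp add: R_def)
    moreover have "closedin (top_of_set R) (F n)" for n
      using F_sub by (simp add: F_def closed_subset)
    ultimately have "top_of_set R interior_of \<Union>(range F) = {}"
      by (intro Baire_category_alt) auto
    moreover have "top_of_set R interior_of R = R"
      using interior_of_topspace[of "top_of_set R"] by simp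
    ultimately show False by (simp add: cover) (simp add: R_def)
  qed
  then obtain n y0 where "y0 \<in> top_of_set R interior_of F n" by blast
  then obtain U where "open U" "y0 \<in> U" "R \<inter> U \<subseteq> F n" "y0 \<in> R"
    unfolding interior_of_def openin_open by auto
  then obtain r where r: "r > 0" "R \<inter> ball y0 r \<subseteq> F n"
    unfolding open_contains_ball by blast
  have sub_R: "u + v \<in> R" "c *\<^sub>R u \<in> R" "u - v \<in> R" if "u \<in> R" "v \<in> R" for u v c
    using that unfolding R_def by (auto simp flip: T.add T.scaleR T.diff)
  \<comment> \<open>The correction built below is a difference of two vectors of norm at most
    \<open>n\<close>, divided by \<open>s = r / (2 * norm y)\<close>, which gives
    \<open>4 * n / r * norm y\<close>. Using \<open>n + 1\<close> keeps \<open>M\<close> positive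
    when \<open>n = 0\<close>.\<close>
  define M where "M = 4 * (real n + 1) / r"
  have "M > 0" using r by (simp add: M_def)
  \<comment> \<open>Scaled to length \<open>r / 2\<close>, \<open>y\<close> can be added to
    \<open>y0\<close> without leaving the ball. Approximating both \<open>y0 + s y\<close> and
    \<open>y0\<close> within \<open>r / 8\<close> and subtracting gives error below
    \<open>r / 4\<close> for \<open>s y\<close>, hence at most \<open>norm y / 2\<close> after
    division by \<open>s\<close>.\<close>
  have step: "\<exists>x. norm x \<le> M * norm y \<and> norm (y - T x) \<le> norm y / 2" if "y \<in> R" for y
  proof (cases "y = 0")
    case True
    then show ?thesis by (intro exI[of _ 0]) (simp add: T.zero)
  next
    case False
    define s where "s = r / (2 * norm y)"
    have s: "s > 0" using False r by (simp add: s_def)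
    have near: "\<exists>x. norm x \<le> real n \<and> norm (w - T x) < r / 8" if "w \<in> F n" for w
    proof -
      have "r / 8 > 0" using r by simp
      with that obtain v where "v \<in> T ` cball 0 (real n)" "dist v w < r / 8"
        unfolding F_def closure_approachable by blast
      then show ?thesis by (auto simp: dist_norm norm_minus_commute)
    qed
    have "y0 + s *\<^sub>R y \<in> R \<inter> ball y0 r"
      using sub_R \<open>y0 \<in> R\<close> that False r by (simp add: dist_norm s_def)
    then obtain a where a: "norm a \<le> real n" "norm (y0 + s *\<^sub>R y - T a) < r / 8"
      using near r by blast
    have "y0 \<in> R \<inter> ball y0 r" using \<open>y0 \<in> R\<close> r by simp
    then obtain b where b: "norm b \<le> real n" "norm (y0 - T b) < r / 8"
      using near r by blast
    define x where "x = (1 / s) *\<^sub>R (a - b)"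
    have "norm x = norm (a - b) / s" using s by (simp add: x_def)
    also have "\<dots> \<le> (2 * real n) / s"
      using a b norm_triangle_ineq4[of a b] s by (intro divide_right_mono) auto
    also have "\<dots> \<le> M * norm y"
      using r False by (simp add: M_def s_def field_simps)
    finally have "norm x \<le> M * norm y" .
    moreover have "norm (y - T x) \<le> norm y / 2"
    proof -
      have "y - T x = (1 / s) *\<^sub>R ((y0 + s *\<^sub>R y - T a) - (y0 - T b))"
        using s by (simp add: x_def T.scaleR T.diff algebra_simps)
      then have "norm (y - T x) = norm ((y0 + s *\<^sub>R y - T a) - (y0 - T b)) / s"
        using s by simp
      also have "\<dots> \<le> (r / 4) / s"
        using a b norm_triangle_ineq4[of "y0 + s *\<^sub>R y - T a" "y0 - T b"] s
        by (intro divide_right_mono) auto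
      also have "\<dots> = norm y / 2" using r False by (simp add: s_def)
      finally show ?thesis .
    qed
    ultimately show ?thesis by blast
  qed
  then obtain g where g: "\<And>y. y \<in> R \<Longrightarrow> norm (g y) \<le> M * norm y"
      "\<And>y. y \<in> R \<Longrightarrow> norm (y - T (g y)) \<le> norm y / 2"
    by metis
  have "\<exists>x. T x = y \<and> norm x \<le> (2 * M) * norm y" if "y \<in> range T" for y
  proof -
    \<comment> \<open>\<open>e k\<close> is the residual after \<open>k\<close> corrections and
      \<open>p k\<close> below is their sum. Residuals at least halve, so the corrections are
      dominated by a geometric series with sum \<open>2 * M * norm y\<close>.\<close>
    define e where "e k = ((\<lambda>v. v - T (g v)) ^^ k) y" for k
    have e_Suc: "e (Suc k) = e k - T (g (e k))" for k by (simp add: e_def)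
    have e_R: "e k \<in> R" for k
    proof (induction k)
      case 0 then show ?case using that by (simp add: e_def R_def)
    next
      case (Suc k)
      then show ?case using sub_R(3)[OF Suc, of "T (g (e k))"] by (simp add: e_Suc R_def)
    qed
    have e_norm: "norm (e k) \<le> norm y * (1/2) ^ k" for k
    proof (induction k)
      case 0 then show ?case by (simp add: e_def)
    next
      case (Suc k)
      then show ?case using g(2)[OF e_R[of k]] by (simp add: e_Suc)
    qed
    define p where "p k = (\<Sum>i<k. g (e i))" for k
    have T_p: "T (p k) = y - e k" for k
      by (induction k) (simp_all add: p_def T.zero T.add e_Suc, simp add: e_def)
    have incr: "norm (g (e i)) \<le> M * norm y * (1/2) ^ i" for i
      using g(1)[OF e_R[of i]] mult_left_mono[OF e_norm[of i], of M] \<open>M > 0\<close>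
      unfolding mult.assoc by linarith
    \<comment> \<open>Keeping the subtracted term makes the induction close: passing from
      \<open>j\<close> to \<open>j + 1\<close> raises the bound by exactly
      \<open>M * norm y * (1/2) ^ j\<close>.\<close>
    have p_diff: "norm (p j - p i) \<le> 2 * M * norm y * ((1/2) ^ i - (1/2) ^ j)" if "i \<le> j" for i j
      using that
    proof (induction j rule: dec_induct)
      case base then show ?case by simp
    next
      case (step j)
      have "norm (p (Suc j) - p i) \<le> norm (p j - p i) + norm (g (e j))"
        using norm_triangle_ineq[of "p j - p i" "g (e j)"] by (simp add: p_def algebra_simps)
      then show ?case using step.IH incr[of j] by (simp add: algebra_simps)
    qed
    have p_diff': "norm (p j - p i) \<le> 2 * M * norm y * (1/2) ^ i" if "i \<le> j" for i j
    proof -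
      have "2 * M * norm y * ((1/2) ^ i - (1/2) ^ j) \<le> 2 * M * norm y * (1/2) ^ i"
        using \<open>M > 0\<close> by (intro mult_left_mono) auto
      then show ?thesis using p_diff[OF that] by linarith
    qed
    have half: "(\<lambda>k. c * (1/2) ^ k) \<longlonglongrightarrow> 0" for c :: real
      by (intro tendsto_mult_right_zero LIMSEQ_power_zero) simp
    have "Cauchy p"
      unfolding Cauchy_altdef2
    proof (intro allI impI)
      fix \<epsilon> :: real assume "\<epsilon> > 0"
      then have "\<forall>\<^sub>F i in sequentially. 2 * M * norm y * (1/2) ^ i < \<epsilon>"
        using half order_tendstoD(2) by blast
      then obtain N where N: "2 * M * norm y * (1/2) ^ N < \<epsilon>"
        by (auto simp: eventually_sequentially)
      then show "\<exists>N. \<forall>k\<ge>N. dist (p k) (p N) < \<epsilon>"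
        using p_diff'[of N] by (intro exI[of _ N]) (auto simp: dist_norm intro: le_less_trans)
    qed
    then obtain x where x: "p \<longlonglongrightarrow> x"
      using Cauchy_convergent convergent_def by blast
    have "e \<longlonglongrightarrow> 0"
      by (rule Lim_null_comparison[OF _ half[of "norm y"]]) (use e_norm in simp)
    then have "(\<lambda>k. T (p k)) \<longlonglongrightarrow> y"
      unfolding T_p using tendsto_diff[OF tendsto_const, of e 0 sequentially y] by simp
    then have "T x = y"
      using LIMSEQ_unique T.tendsto[OF x] by blast
    moreover have "norm x \<le> 2 * M * norm y"
      using p_diff'[of 0] by (intro LIMSEQ_le_const2[OF tendsto_norm[OF x]]) (simp add: p_def)
    ultimately show ?thesis by blast
  qed
  with \<open>M > 0\<close> show ?thesis by (intro that[of "2 * M"]) auto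
qed

section \<open>Generalized inverses and projections\<close>

lemma range_id_minus_eq_null_space:
  assumes "B (0::'a::real_vector) = 0" "\<And>x y. B (x - y) = B x - (B y::'b::real_vector)"
    and "C 0 = 0" and "B \<circ> C \<circ> B = B"
  shows "range (\<lambda>x. x - C (B x)) = null_space B"
proof -
  have "B (x - C (B x)) = 0" for x
    using fun_cong[OF assms(4), of x] by (simp add: assms(2))
  moreover have "x = x - C (B x)" if "B x = 0" for x
    using that assms(3) by simp
  ultimately show ?thesis unfolding null_space_def by blast
qed

text \<open>\<open>N(Q1)\<close> is a complement of \<open>R(Q1) = N(B)\<close>, so each
  \<open>Q2 y\<close> in \<open>R(B)\<close> has exactly one preimage in it; that preimage is
  \<open>C y\<close>.\<close>

lemma inverse_from_projections:
  fixes B :: "'h::chilbert_space \<Rightarrow> 'k::chilbert_space"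
  assumes B: "bounded_clinear B" and closed: "closed (range B)"
    and Q1: "bounded_clinear Q1" "Q1 \<circ> Q1 = Q1" "range Q1 = null_space B"
    and Q2: "bounded_clinear Q2" "Q2 \<circ> Q2 = Q2" "range Q2 = range B"
  obtains C where "bounded_clinear C" "\<And>x. C (B x) = x - Q1 x" "\<And>y. B (C y) = Q2 y"
    "\<And>y. Q1 (C y) = 0"
proof -
  have blB: "bounded_linear B" and BC: "\<And>c x. B (c *\<^sub>C x) = c *\<^sub>C B x"
    and blQ1: "bounded_linear Q1" and Q1C: "\<And>c x. Q1 (c *\<^sub>C x) = c *\<^sub>C Q1 x"
    and blQ2: "bounded_linear Q2" and Q2C: "\<And>c x. Q2 (c *\<^sub>C x) = c *\<^sub>C Q2 x"
    using B Q1(1) Q2(1) by (auto simp: bounded_clinear_def)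
  interpret B: bounded_linear B by fact
  interpret Q1: bounded_linear Q1 by fact
  interpret Q2: bounded_linear Q2 by fact
  have Q1_fix: "Q1 x = x" if "B x = 0" for x
    using that Q1(2,3) by (auto simp: null_space_def fun_eq_iff set_eq_iff image_iff) metis
  have BQ1: "B (Q1 x) = 0" for x
    using Q1(3) by (auto simp: null_space_def)
  have Q2_B: "Q2 (B x) = B x" for x
    using Q2(2,3) by (metis comp_apply rangeE rangeI)
  \<comment> \<open>An arbitrary choice of preimages, not claimed linear or bounded. Subtracting the
    \<open>Q1\<close> component in \<open>C\<close> moves the chosen preimage into
    \<open>N(Q1)\<close>.\<close>
  define g where "g z = (SOME x. B x = z)" for z
  have Bg: "B (g (Q2 y)) = Q2 y" for y
  proof -
    have "\<exists>x. B x = Q2 y" using Q2(3) by (metis rangeE rangeI)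
    then show ?thesis unfolding g_def by (rule someI_ex)
  qed
  define C where "C y = g (Q2 y) - Q1 (g (Q2 y))" for y
  \<comment> \<open>Independence of the preimage: two preimages differ by an element of \<open>N(B) = R(Q1)\<close>.\<close>
  have C_eq: "C y = x - Q1 x" if "B x = Q2 y" for x y
  proof -
    have "B (g (Q2 y) - x) = 0" by (simp add: B.diff Bg that)
    from Q1_fix[OF this] show ?thesis
      unfolding C_def by (simp add: Q1.diff algebra_simps)
  qed
  have C_B: "C (B x) = x - Q1 x" for x by (rule C_eq) (simp add: Q2_B)
  moreover have B_C: "B (C y) = Q2 y" for y by (simp add: C_def B.diff BQ1 Bg)
  moreover have "Q1 (C y) = 0" for y
    using Q1(2) by (simp add: C_def Q1.diff fun_eq_iff)
  moreover have "bounded_clinear C"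
    unfolding bounded_clinear_def
  proof
    obtain M where M: "M > 0" "\<And>y. y \<in> range B \<Longrightarrow> \<exists>x. B x = y \<and> norm x \<le> M * norm y"
      using closed_range_bounded_preimage[OF blB closed] by blast
    obtain K1 where K1: "\<And>x. norm (x - Q1 x) \<le> norm x * K1" "K1 \<ge> 0"
      using bounded_linear.nonneg_bounded[OF bounded_linear_sub[OF bounded_linear_ident blQ1]] by blast
    obtain K2 where K2: "\<And>y. norm (Q2 y) \<le> norm y * K2"
      using Q2.bounded by blast
    \<comment> \<open>By \<open>C_eq\<close> any preimage computes \<open>C\<close>; here it is the
      sum of the chosen ones, and for scalars a multiple.\<close>
    have add: "C (x + y) = C x + C y" for x y
    proof -
      have "C (x + y) = (g (Q2 x) + g (Q2 y)) - Q1 (g (Q2 x) + g (Q2 y))"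
        by (rule C_eq) (simp add: B.add Bg Q2.add)
      then show ?thesis by (simp add: C_def Q1.add)
    qed
    show scale: "\<forall>c x. C (c *\<^sub>C x) = c *\<^sub>C C x"
    proof (intro allI)
      fix c x
      have "C (c *\<^sub>C x) = c *\<^sub>C g (Q2 x) - Q1 (c *\<^sub>C g (Q2 x))"
        by (rule C_eq) (simp add: BC Bg Q2C)
      then show "C (c *\<^sub>C x) = c *\<^sub>C C x"
        by (simp add: C_def Q1C scaleC_diff_right)
    qed
    show "bounded_linear C"
    proof (rule bounded_linear_intro)
      show "norm (C y) \<le> norm y * (K2 * M * K1)" for y
      proof -
        \<comment> \<open>For the bound, the chosen preimage is exchanged for a norm-controlled one.
          The factors \<open>K2\<close>, \<open>M\<close> and \<open>K1\<close> bound
          \<open>Q2\<close>, the preimage and \<open>1 - Q1\<close> respectively.\<close>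
        obtain x where x: "B x = Q2 y" "norm x \<le> M * norm (Q2 y)"
          using M(2)[of "Q2 y"] Q2(3) by blast
        have "norm (C y) \<le> norm x * K1" using C_eq[OF x(1)] K1(1) by simp
        also have "\<dots> \<le> (M * (norm y * K2)) * K1"
          using x(2) mult_left_mono[OF K2[of y], of M] M(1) K1(2)
          by (intro mult_right_mono) linarith+
        finally show ?thesis by (simp add: mult_ac)
      qed
    qed (use add scale in \<open>simp_all add: scaleR_eq_scaleC\<close>)
  qed
  ultimately show ?thesis using that by blast
qed

section \<open>Equivalence of weighted inverses and compatibility\<close>

theorem theorem3p1:
  fixes B :: "'h::chilbert_space \<Rightarrow> 'k::chilbert_space"
    and A1 :: "'h \<Rightarrow> 'h" and A2 :: "'k \<Rightarrow> 'k"
  assumes "bounded_clinear B" and "closed (range B)"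
    and "positive_operator A1" and "positive_operator A2"
  shows "(\<exists>C :: 'k \<Rightarrow> 'h. bounded_clinear C \<and>
            B \<circ> C \<circ> B = B \<and>
            C \<circ> B \<circ> C = C \<and>
            A1 \<circ> C \<circ> B = cadjoint B \<circ> cadjoint C \<circ> A1 \<and>
            A2 \<circ> B \<circ> C = cadjoint C \<circ> cadjoint B \<circ> A2)
    \<longleftrightarrow> compatible A1 (null_space B) \<and> compatible A2 (range B)"
proof -
  note B = assms(1)
  interpret B: bounded_linear B using B by (simp add: bounded_clinear_def)
  interpret A1: bounded_linear A1
    using assms(3) by (simp add: positive_operator_def bounded_clinear_def)
  \<comment> \<open>The weighted conditions say that \<open>C B\<close> and \<open>B C\<close> are
    symmetric for the semidefinite forms \<open>cinner y (A1 x)\<close> and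
    \<open>cinner y (A2 x)\<close>.\<close>
  have adj1: "A1 \<circ> C \<circ> B = cadjoint B \<circ> cadjoint C \<circ> A1 \<longleftrightarrow>
      (\<forall>x y. cinner y (A1 (C (B x))) = cinner (C (B y)) (A1 x))"
    and adj2: "A2 \<circ> B \<circ> C = cadjoint C \<circ> cadjoint B \<circ> A2 \<longleftrightarrow>
      (\<forall>x y. cinner y (A2 (B (C x))) = cinner (B (C y)) (A2 x))"
    if "bounded_clinear C" for C
    using eq_cadjoint_comp_iff[OF B, of "A1 \<circ> C \<circ> B" "cadjoint C \<circ> A1"]
      eq_cadjoint_comp_iff[OF that, of "A2 \<circ> B \<circ> C" "cadjoint B \<circ> A2"]
    by (simp_all add: comp_assoc cinner_cadjoint[OF B] cinner_cadjoint[OF that])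
  show ?thesis
  proof (intro iffI conjI)
    assume "\<exists>C :: 'k \<Rightarrow> 'h. bounded_clinear C \<and> B \<circ> C \<circ> B = B \<and> C \<circ> B \<circ> C = C \<and>
        A1 \<circ> C \<circ> B = cadjoint B \<circ> cadjoint C \<circ> A1 \<and>
        A2 \<circ> B \<circ> C = cadjoint C \<circ> cadjoint B \<circ> A2"
    then obtain C where C: "bounded_clinear C" and BCB: "B \<circ> C \<circ> B = B"
      and A1C: "\<forall>x y. cinner y (A1 (C (B x))) = cinner (C (B y)) (A1 x)"
      and A2C: "\<forall>x y. cinner y (A2 (B (C x))) = cinner (B (C y)) (A2 x)"
      using adj1 adj2 by metis
    interpret C: bounded_linear C using C by (simp add: bounded_clinear_def)
    have BCB': "B (C (B x)) = B x" for x using BCB by (simp add: fun_eq_iff)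
    show "compatible A1 (null_space B)"
      unfolding compatible_def
    proof (intro exI conjI)
      let ?Q = "\<lambda>x. x - C (B x)"
      show Q: "bounded_clinear ?Q"
        using bounded_clinear_id_minus[OF bounded_clinear_compose[OF C B]] by simp
      show "?Q \<circ> ?Q = ?Q" by (simp add: fun_eq_iff B.diff C.diff BCB')
      show "range ?Q = null_space B"
        by (rule range_id_minus_eq_null_space[OF B.zero B.diff C.zero BCB])
      \<comment> \<open>The identity is trivially symmetric for the form of \<open>A1\<close>, so
        symmetry passes from \<open>C B\<close> to \<open>1 - C B\<close>.\<close>
      show "A1 \<circ> ?Q = cadjoint ?Q \<circ> A1"
        unfolding eq_cadjoint_comp_iff[OF Q]
        using A1C by (simp add: A1.diff cinner_diff_left cinner_diff_right)
    qed
    show "compatible A2 (range B)"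
      unfolding compatible_def
    proof (intro exI conjI)
      show Q: "bounded_clinear (B \<circ> C)" by (rule bounded_clinear_compose[OF B C])
      show "(B \<circ> C) \<circ> (B \<circ> C) = B \<circ> C" by (simp add: fun_eq_iff BCB')
      show "range (B \<circ> C) = range B"
        using BCB' by (metis BCB fun.set_map image_comp image_mono subset_UNIV subset_antisym)
      show "A2 \<circ> (B \<circ> C) = cadjoint (B \<circ> C) \<circ> A2"
        unfolding eq_cadjoint_comp_iff[OF Q] using A2C by simp
    qed
  next
    assume "compatible A1 (null_space B) \<and> compatible A2 (range B)"
    then obtain Q1 Q2
      where Q1: "bounded_clinear Q1" "Q1 \<circ> Q1 = Q1" "range Q1 = null_space B"
        and AQ1: "A1 \<circ> Q1 = cadjoint Q1 \<circ> A1"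
        and Q2: "bounded_clinear Q2" "Q2 \<circ> Q2 = Q2" "range Q2 = range B"
        and AQ2: "A2 \<circ> Q2 = cadjoint Q2 \<circ> A2"
      unfolding compatible_def by blast
    obtain C where C: "bounded_clinear C" "\<And>x. C (B x) = x - Q1 x" "\<And>y. B (C y) = Q2 y"
        "\<And>y. Q1 (C y) = 0"
      using inverse_from_projections[OF B assms(2) Q1 Q2] by blast
    have "B (Q1 x) = 0" for x
      using Q1(3) by (auto simp: null_space_def)
    then have "B \<circ> C \<circ> B = B"
      by (simp add: fun_eq_iff C(2) B.diff)
    \<comment> \<open>Here \<open>C B = 1 - Q1\<close> is applied to vectors of \<open>R(C)\<close>,
      on which \<open>Q1\<close> vanishes.\<close>
    moreover have "C \<circ> B \<circ> C = C"
      using C(2)[of "C _"] by (simp add: fun_eq_iff C(2,4) del: C(3))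
    moreover have "\<forall>x y. cinner y (A1 (C (B x))) = cinner (C (B y)) (A1 x)"
      using AQ1 unfolding eq_cadjoint_comp_iff[OF Q1(1)]
      by (simp add: C(2) A1.diff cinner_diff_left cinner_diff_right)
    moreover have "\<forall>x y. cinner y (A2 (B (C x))) = cinner (B (C y)) (A2 x)"
      using AQ2 unfolding eq_cadjoint_comp_iff[OF Q2(1)] by (simp add: C(3))
    ultimately show "\<exists>C :: 'k \<Rightarrow> 'h. bounded_clinear C \<and> B \<circ> C \<circ> B = B \<and> C \<circ> B \<circ> C = C \<and>
        A1 \<circ> C \<circ> B = cadjoint B \<circ> cadjoint C \<circ> A1 \<and>
        A2 \<circ> B \<circ> C = cadjoint C \<circ> cadjoint B \<circ> A2"
      using C(1) adj1 adj2 by blast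
  qed
qed

end
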